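(* For every integer $m\ge1$ the series below converges and $$\sum_{n=1}^{\infty}\frac{H_n^m-(\log n+\gamma)^m}{n}={}_m\tilde\gamma_0-\sum_{k=0}^m\binom{m}{k}\gamma^{m-k}\gamma_k$$ $$=-\frac{m}{m+1}\gamma^{m+1}+(-1)^{m+1}\frac{\zeta(m+1)}{m+1}+\sum_{k=0}^{m-2}\binom{m+1}{k+1}\frac{(-1)^{k+m}\mathcal{H}^{k+1}(m-k)}{m+1}-\sum_{k=1}^m\binom{m}{k}\gamma_k\gamma^{m-k}.$$
   Context: $H_n=1+\frac12+\cdots+\frac1n$; for integers $j\ge0$, $\mathcal{H}^j(s)=\sum_{n\ge1}H_n^j n^{-s}$ ($\Re(s)>1$), meromorphically continued. $\zeta$ is the Riemann zeta function, $\gamma$ the Euler–Mascheroni constant, and $\gamma_k=\lim_{N\to\infty}\left(\sum_{j=1}^N\frac{\log^k j}{j}-\frac{\log^{k+1}N}{k+1}\right)$ are the Stieltjes constants ($\gamma_0=\gamma$). ${}_m\tilde\gamma_0$ is the constant term in the Laurent expansion $\mathcal{H}^m(s)=\sum_{j=0}^m\binom{m}{j}\gamma^{m-j}j!\,(s-1)^{-j-1}+\sum_{n\ge0}\frac{(-1)^n}{n!}{}_m\tilde\gamma_n(s-1)^n$ about $s=1$. *)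

theory Defs
  imports "HOL-Complex_Analysis.Complex_Analysis"
begin

text \<open>
  The meromorphic continuation of the Dirichlet series with coefficients \<open>a 1, a 2, \<dots>\<close>
  from \<open>Re s > 1\<close> to \<open>Re s > 0\<close>; the half-plane \<open>Re s > 0\<close> contains \<open>1\<close>, which is all that is
  needed for the Laurent expansion there. Such a continuation, if it exists, is unique
  up to its values on a discrete set of points in \<open>Re s \<le> 1\<close>, and Laurent expansions do not
  depend on those values. Outside \<open>Re s > 0\<close> the function is unspecified.
\<close>
definition dirichlet_continuation :: "(nat \<Rightarrow> complex) \<Rightarrow> complex \<Rightarrow> complex" where
  "dirichlet_continuation a =
     (SOME F. F meromorphic_on {s. Re s > 0} \<and>
        (\<forall>s. Re s > 1 \<longrightarrow> F s = (\<Sum>n. a (Suc n) / of_nat (Suc n) powr s)))"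

definition riemann_zeta :: "complex \<Rightarrow> complex" where
  "riemann_zeta = dirichlet_continuation (\<lambda>_. 1)"

definition harm_zeta :: "nat \<Rightarrow> complex \<Rightarrow> complex" where
  "harm_zeta j = dirichlet_continuation (\<lambda>n. harm n ^ j)"

definition stieltjes :: "nat \<Rightarrow> real" where
  "stieltjes k =
     lim (\<lambda>N. (\<Sum>j=1..N. ln (real j) ^ k / real j) - ln (real N) ^ (k + 1) / real (k + 1))"

text \<open>
  The coefficient of \<open>(s - 1)^n\<close> in the Laurent expansion of \<open>harm_zeta m\<close> about \<open>1\<close>
  is \<open>(-1)^n / n!\<close> times \<open>harm_stieltjes m n\<close>.
\<close>
definition harm_stieltjes :: "nat \<Rightarrow> nat \<Rightarrow> complex" where
  "harm_stieltjes m n =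
     (-1) ^ n * fact n * fls_nth (laurent_expansion (harm_zeta m) 1) (int n)"

end

(*
  The functions sum_n (ln n)^k n^-s are, up to sign, the derivatives of zeta. Comparing the zeta
  series with the integral of x^-s term by term gives a series that converges locally uniformly
  for Re s > 0; its k-th derivative at 1 is the k-th Stieltjes constant, up to sign. Since H_n^m
  and (ln n + gamma)^m differ by O((ln n)^(m-1) / n), the difference of the two Dirichlet series is
  holomorphic on Re s > 0 too, and the constant term at 1 can be read off. The second closed form
  comes from telescoping H_n^(m+1) - (H_n - 1/n)^(m+1).
*)
theory Submission
  imports Defs "HOL-Real_Asymp.Real_Asymp"
begin

text \<open>\<open>dirichlet_continuation\<close> is a choice, so near 1 nothing is given about
  \<open>harm_zeta m\<close> beyond meromorphy. The explicit function
  \<open>harm_zeta_regular m\<close> plus \<open>harm_zeta_polar m\<close> serves twice: it shows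
  that the choice is not void, and by the identity principle it agrees with the chosen function near
  1. The arguments p >= 2 of the second closed form lie in Re s > 1, where the choice is pinned
  down. The obstacle at s = 1 is that x^(1-s)/(1-s) has a pole there while its differences between
  positive integers do not; multiplying by s - 1 removes it. The two closed forms are not compared
  directly: both are values of the same series. In the second evaluation H_N^(m+1)/(m+1) cancels in
  the limit against (ln N + gamma)^(m+1)/(m+1), which the Stieltjes normalisations produce together
  with a constant gamma^(m+1)/(m+1). Subtracting the k = 0 term gamma^(m+1) turns that constant into
  -m/(m+1) gamma^(m+1).\<close>

section \<open>Locally uniform series of holomorphic functions\<close>

lemma
  fixes f :: "nat \<Rightarrow> complex \<Rightarrow> complex"
  assumes S: "open S" and holo: "\<And>n. f n holomorphic_on S"
    and bound: "\<And>z. z \<in> S \<Longrightarrow> \<exists>r>0. \<exists>M. cball z r \<subseteq> S \<and> summable M \<and> (\<forall>n. \<forall>w\<in>cball z r. norm (f n w) \<le> M n)"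
  shows holomorphic_suminf: "(\<lambda>z. \<Sum>n. f n z) holomorphic_on S"
    and higher_deriv_sums: "z \<in> S \<Longrightarrow> (\<lambda>n. (deriv ^^ k) (f n) z) sums (deriv ^^ k) (\<lambda>z. \<Sum>n. f n z) z"
proof -
  \<comment> \<open>A majorant on one closed disc around each point is enough: holomorphy and
    derivatives are local.\<close>
  have unif: "\<exists>r>0. cball z r \<subseteq> S \<and> uniform_limit (cball z r) (\<lambda>n x. \<Sum>i<n. f i x) (\<lambda>x. \<Sum>i. f i x) sequentially"
    if z: "z \<in> S" for z
  proof -
    obtain r M where r: "r > 0" "cball z r \<subseteq> S" and M: "summable M" "\<forall>n. \<forall>w\<in>cball z r. norm (f n w) \<le> M n"
      using bound[OF z] by metis
    have "uniform_limit (cball z r) (\<lambda>n x. \<Sum>i<n. f i x) (\<lambda>x. \<Sum>i. f i x) sequentially"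
      by (rule Weierstrass_m_test[where M = M]) (use M in auto)
    with r show ?thesis
      by auto
  qed
  show "(\<lambda>z. \<Sum>n. f n z) holomorphic_on S"
    by (rule holomorphic_uniform_sequence[OF S, of "\<lambda>n x. \<Sum>i<n. f i x"])
      (use unif in \<open>simp_all add: holomorphic_on_sum holo\<close>)
  show "(\<lambda>n. (deriv ^^ k) (f n) z) sums (deriv ^^ k) (\<lambda>z. \<Sum>n. f n z) z" if z: "z \<in> S"
  proof -
    obtain r where r: "r > 0" "cball z r \<subseteq> S"
      "uniform_limit (cball z r) (\<lambda>n x. \<Sum>i<n. f i x) (\<lambda>x. \<Sum>i. f i x) sequentially"
      using unif[OF z] by blast
    have holo': "f n holomorphic_on ball z r" for n
      using r(2) ball_subset_cball holo holomorphic_on_subset by (metis (no_types, lifting) subset_trans)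
    have *: "(deriv ^^ k) (\<lambda>x. \<Sum>i<n. f i x) z = (\<Sum>i<n. (deriv ^^ k) (f i) z)" for n
    proof (induction n)
      case 0
      have "(deriv ^^ k) (\<lambda>_::complex. 0::complex) z = 0" by (induction k arbitrary: z) auto
      then show ?case by simp
    next
      case (Suc n)
      then show ?case
        using higher_deriv_add[of "\<lambda>x. \<Sum>i<n. f i x" S "f n" z k] holo S z
        by (auto intro!: holomorphic_intros)
    qed
    have "(\<lambda>n. (deriv ^^ k) (\<lambda>x. \<Sum>i<n. f i x) z) \<longlonglongrightarrow> (deriv ^^ k) (\<lambda>x. \<Sum>i. f i x) z"
      using r by (intro higher_deriv_complex_uniform_limit[where A = "ball z r"])
        (auto intro!: always_eventually holomorphic_intros holo' intro: uniform_limit_on_subset)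
    then show ?thesis
      by (simp add: * sums_def)
  qed
qed

section \<open>Dirichlet series whose coefficients grow like powers of the logarithm\<close>

text \<open>Half of the surplus \<delta> absorbs the logarithms, the other half keeps the exponent
  beyond 1.\<close>

lemma summable_ln_power_powr:
  fixes c \<delta> :: real
  assumes "\<delta> > 0"
  shows "summable (\<lambda>n. (ln (real (Suc n)) + c) ^ k * real (Suc n) powr - (1 + \<delta>))"
proof (rule summable_comparison_test_bigo)
  have "summable (\<lambda>n. real n powr - (1 + \<delta> / 2))"
    using assms by (simp add: summable_real_powr_iff)
  then show "summable (\<lambda>n. norm (real (Suc n) powr - (1 + \<delta> / 2)))"
    by (subst (asm) summable_Suc_iff [symmetric]) simp
  \<comment> \<open>The exponent allotted to each of the k logarithmic factors;
    \<open>real k + 1\<close> keeps the denominator positive for k = 0.\<close>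
  define \<epsilon> where "\<epsilon> = \<delta> / (2 * (real k + 1))"
  have \<epsilon>: "\<epsilon> > 0" "real k * \<epsilon> \<le> \<delta> / 2"
    using assms by (simp_all add: \<epsilon>_def field_simps)
  have "(\<lambda>n. ln (real (Suc n)) + c) \<in> O(\<lambda>n. real (Suc n) powr \<epsilon>)"
    using \<epsilon>(1) by real_asymp
  then have "(\<lambda>n. (ln (real (Suc n)) + c) ^ k * real (Suc n) powr - (1 + \<delta>))
      \<in> O(\<lambda>n. (real (Suc n) powr \<epsilon>) ^ k * real (Suc n) powr - (1 + \<delta>))"
    by (intro landau_o.big.mult landau_o.big_power) auto
  also have "(\<lambda>n. (real (Suc n) powr \<epsilon>) ^ k * real (Suc n) powr - (1 + \<delta>)) =
      (\<lambda>n. real (Suc n) powr (real k * \<epsilon> - (1 + \<delta>)))"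
    by (simp add: powr_power powr_add [symmetric] algebra_simps del: of_nat_Suc)
  also have "\<dots> \<in> O(\<lambda>n. real (Suc n) powr - (1 + \<delta> / 2))"
  proof (rule landau_o.big_mono, intro always_eventually allI)
    fix n
    show "norm (real (Suc n) powr (real k * \<epsilon> - (1 + \<delta>))) \<le> norm (real (Suc n) powr - (1 + \<delta> / 2))"
      using \<epsilon>(2) by (auto intro!: powr_mono simp del: of_nat_Suc)
  qed
  finally show "(\<lambda>n. (ln (real (Suc n)) + c) ^ k * real (Suc n) powr - (1 + \<delta>)) \<in> O(\<lambda>n. real (Suc n) powr - (1 + \<delta> / 2))" .
qed

text \<open>Delivers the majorants for the termwise theorems above. The parameter e records the
  decay of the coefficients: e = 0 suits powers of H_n and gives Re s > 1, e = 1 suits their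
  deviation from powers of ln n + gamma and gives Re s > 0.\<close>

lemma dirichlet_series_bound:
  fixes a :: "nat \<Rightarrow> complex"
  assumes a: "\<And>n. norm (a n) \<le> B * (ln (real (Suc n)) + c) ^ k / real (Suc n) powr e"
    and z: "Re z > 1 - e"
  shows "\<exists>r>0. \<exists>M. cball z r \<subseteq> {s. Re s > 1 - e} \<and> summable M \<and>
           (\<forall>n. \<forall>w\<in>cball z r. norm (a n / of_nat (Suc n) powr w) \<le> M n)"
proof (intro exI conjI allI ballI)
  \<comment> \<open>Half the distance from z to the boundary line, so the disc stays at least
    \<open>?r\<close> away from that line.\<close>
  let ?r = "(Re z - (1 - e)) / 2"
  show "?r > 0" using z by simp
  have Re: "Re w \<ge> 1 - e + ?r" if "w \<in> cball z ?r" for w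
    using that complex_Re_le_cmod[of "z - w"] by (simp add: dist_norm field_simps)
  show "cball z ?r \<subseteq> {s. Re s > 1 - e}"
  proof
    fix w assume "w \<in> cball z ?r"
    then show "w \<in> {s. Re s > 1 - e}"
      using Re[of w] z by (simp add: field_simps)
  qed
  show "summable (\<lambda>n. B * ((ln (real (Suc n)) + c) ^ k * real (Suc n) powr - (1 + ?r)))"
    using z by (intro summable_mult summable_ln_power_powr) simp
  fix n w assume w: "w \<in> cball z ?r"
  have "norm (a n / of_nat (Suc n) powr w) = norm (a n) * real (Suc n) powr - Re w"
    by (simp add: norm_divide norm_powr_real_powr powr_minus_divide del: of_nat_Suc)
  also have "\<dots> \<le> norm (a n) * real (Suc n) powr - (1 - e + ?r)"
    using Re[OF w] by (intro mult_left_mono powr_mono) auto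
  also have "\<dots> \<le> B * (ln (real (Suc n)) + c) ^ k / real (Suc n) powr e * real (Suc n) powr - (1 - e + ?r)"
    using a by (intro mult_right_mono) auto
  also have "\<dots> = B * ((ln (real (Suc n)) + c) ^ k * (real (Suc n) powr - e * real (Suc n) powr - (1 - e + ?r)))"
    by (simp add: powr_minus_divide del: of_nat_Suc)
  also have "real (Suc n) powr - e * real (Suc n) powr - (1 - e + ?r) = real (Suc n) powr - (1 + ?r)"
    by (subst powr_add [symmetric]) (rule arg_cong2[where f = "(powr)"], simp, simp add: field_simps)
  finally show "norm (a n / of_nat (Suc n) powr w) \<le> B * ((ln (real (Suc n)) + c) ^ k * real (Suc n) powr - (1 + ?r))" .
qed

lemma
  fixes a :: "nat \<Rightarrow> complex"
  assumes a: "\<And>n. norm (a n) \<le> B * (ln (real (Suc n)) + c) ^ k / real (Suc n) powr e"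
  shows holomorphic_dirichlet_series:
      "(\<lambda>s. \<Sum>n. a n / of_nat (Suc n) powr s) holomorphic_on {s. Re s > 1 - e}"
    and summable_dirichlet_series:
      "Re z > 1 - e \<Longrightarrow> summable (\<lambda>n. a n / of_nat (Suc n) powr z)"
    and higher_deriv_dirichlet_series_sums:
      "Re z > 1 - e \<Longrightarrow> (\<lambda>n. (deriv ^^ j) (\<lambda>s. a n / of_nat (Suc n) powr s) z) sums
         (deriv ^^ j) (\<lambda>s. \<Sum>n. a n / of_nat (Suc n) powr s) z"
proof -
  have op: "open {s. Re s > 1 - e}"
    by (simp add: open_halfspace_Re_gt)
  moreover have holo: "(\<lambda>s. a n / of_nat (Suc n) powr s) holomorphic_on {s. Re s > 1 - e}" for n
    by (intro holomorphic_intros) (auto simp del: of_nat_Suc)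
  ultimately show "(\<lambda>s. \<Sum>n. a n / of_nat (Suc n) powr s) holomorphic_on {s. Re s > 1 - e}"
    by (rule holomorphic_suminf) (rule dirichlet_series_bound[OF a], simp_all)
  show *: "Re z > 1 - e \<Longrightarrow> (\<lambda>n. (deriv ^^ j) (\<lambda>s. a n / of_nat (Suc n) powr s) z) sums
         (deriv ^^ j) (\<lambda>s. \<Sum>n. a n / of_nat (Suc n) powr s) z" for j
    using op holo
    by (rule higher_deriv_sums) (rule dirichlet_series_bound[OF a], simp_all)
  show "Re z > 1 - e \<Longrightarrow> summable (\<lambda>n. a n / of_nat (Suc n) powr z)"
    using *[of 0] by (auto dest: sums_summable)
qed

section \<open>Comparison of n^-s with the integral of x^-s\<close>

text \<open>The exponent c - s covers both uses: c = 0 for the terms of the zeta series, c = 1 for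
  the endpoint values of the integrals.\<close>

lemma higher_deriv_of_nat_powr:
  fixes c :: complex
  assumes "n > 0"
  shows "(deriv ^^ k) (\<lambda>s. of_nat n powr (c - s)) s = (- of_real (ln (real n))) ^ k * of_nat n powr (c - s)"
proof (induction k arbitrary: s)
  case (Suc k)
  have "(deriv ^^ k) (\<lambda>s. of_nat n powr (c - s)) = (\<lambda>s. (- of_real (ln (real n))) ^ k * of_nat n powr (c - s))"
    using Suc by blast
  then have D: "(deriv ^^ Suc k) (\<lambda>s. of_nat n powr (c - s)) s
      = deriv (\<lambda>s. (- of_real (ln (real n))) ^ k * of_nat n powr (c - s)) s"
    by simp
  have "((\<lambda>s. of_nat n powr (c - s)) has_field_derivative Ln (of_nat n) * of_nat n powr (c - s) * (0 - 1)) (at s)"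
    using assms
    by (intro DERIV_chain2[OF has_field_derivative_powr_right] derivative_intros) auto
  then have "deriv (\<lambda>s. (- of_real (ln (real n))) ^ k * of_nat n powr (c - s)) s =
      (- of_real (ln (real n))) ^ k * (Ln (of_nat n) * of_nat n powr (c - s) * (0 - 1))"
    by (intro DERIV_imp_deriv DERIV_cmult)
  also have "\<dots> = (- of_real (ln (real n))) ^ Suc k * of_nat n powr (c - s)"
    using assms by (simp add: Ln_of_nat)
  finally show ?case
    using D by simp
qed auto

text \<open>A primitive of z^-s in z. As a function of s it is discontinuous at 1, but only
  differences between two endpoints are used, and there the logarithmic value is the right
  one.\<close>

definition powr_primitive :: "complex \<Rightarrow> complex \<Rightarrow> complex" where
  "powr_primitive s z = (if s = 1 then Ln z else z powr (1 - s) / (1 - s))"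

lemma has_field_derivative_powr_primitive:
  assumes "Re z > 0"
  shows "(powr_primitive s has_field_derivative z powr (- s)) (at z)"
proof -
  have z: "z \<notin> \<real>\<^sub>\<le>\<^sub>0"
    using assms by (auto elim!: nonpos_Reals_cases)
  show ?thesis
  proof (cases "s = 1")
    case True
    have "(Ln has_field_derivative inverse z) (at z)"
      using z by (rule has_field_derivative_Ln)
    then show ?thesis
      using True z by (auto simp: powr_primitive_def [abs_def] powr_minus)
  next
    case False
    have "((\<lambda>z. z powr (1 - s) / (1 - s)) has_field_derivative (1 - s) * z powr (1 - s - 1) / (1 - s)) (at z)"
      using z False by (intro DERIV_cdivide has_field_derivative_powr)
    then show ?thesis
      using False by (simp add: powr_primitive_def [abs_def])
  qed
qed

text \<open>The last bracket is the integral of x^-s over [n+1, n+2]. For Re s > 1 these integrals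
  add up to 1/(s-1), the pole of zeta.\<close>

definition zeta_remainder :: "nat \<Rightarrow> complex \<Rightarrow> complex" where
  "zeta_remainder n s = 1 / of_nat (Suc n) powr s
     - (powr_primitive s (of_nat (Suc (Suc n))) - powr_primitive s (of_nat (Suc n)))"

text \<open>The remainder is the integral of a^-s - x^-s over a unit interval starting at a = n+1,
  and x^-s has derivative of size |s| x^(-1-Re s). The mean value inequality is applied twice, so no
  integral appears.\<close>

lemma norm_zeta_remainder_le:
  assumes s: "Re s > 0"
  shows "norm (zeta_remainder n s) \<le> norm s * real (Suc n) powr - (1 + Re s)"
proof -
  let ?a = "complex_of_real (real (Suc n))" and ?b = "complex_of_real (real (Suc (Suc n)))"
  let ?B = "norm s * real (Suc n) powr - (1 + Re s)"
  have seg: "\<exists>x \<ge> real (Suc n). x \<le> real (Suc (Suc n)) \<and> z = of_real x" if "z \<in> closed_segment ?a ?b" for z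
    using that unfolding closed_segment_of_real closed_segment_eq_real_ivl by auto
  have pos: "z \<notin> \<real>\<^sub>\<le>\<^sub>0" "Re z > 0" if "z \<in> closed_segment ?a ?b" for z
    using seg[OF that] by auto
  have 1: "norm (z powr (- s) - ?a powr (- s)) \<le> ?B" if z: "z \<in> closed_segment ?a ?b" for z
  proof -
    have "norm (z powr (- s) - ?a powr (- s)) \<le> ?B * norm (z - ?a)"
    proof (rule field_differentiable_bound[where S = "closed_segment ?a ?b" and f' = "\<lambda>w. (- s) * w powr (- s - 1)"])
      fix w assume w: "w \<in> closed_segment ?a ?b"
      show "((\<lambda>w. w powr (- s)) has_field_derivative - s * w powr (- s - 1)) (at w within closed_segment ?a ?b)"
        by (rule has_field_derivative_at_within [OF has_field_derivative_powr[OF pos(1)[OF w]]])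
      obtain x where x: "x \<ge> real (Suc n)" "w = of_real x"
        using seg[OF w] by blast
      have "norm (w powr (- s - 1)) = x powr Re (- s - 1)"
        using x by (simp add: norm_powr_real_powr)
      also have "\<dots> = x powr - (1 + Re s)"
        by (rule arg_cong[where f = "(powr) x"]) simp
      also have "\<dots> \<le> real (Suc n) powr - (1 + Re s)"
        using x s by (intro powr_mono2') auto
      finally show "norm (- s * w powr (- s - 1)) \<le> ?B"
        by (simp add: norm_mult mult_left_mono)
    qed (use z in auto)
    also have "norm (z - ?a) \<le> 1"
    proof -
      obtain x where x: "x \<ge> real (Suc n)" "x \<le> real (Suc (Suc n))" "z = of_real x"
        using seg[OF z] by blast
      show ?thesis
        unfolding x of_real_diff [symmetric] norm_of_real using x by auto
    qed
    finally show ?thesis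
      by (auto simp: mult_left_mono)
  qed
  \<comment> \<open>The function z -> \<open>powr_primitive s z - z * ?a powr (- s)\<close> has the
    difference just bounded as its derivative, and its increment over the segment is minus the
    remainder.\<close>
  have "norm ((powr_primitive s ?b - ?b * ?a powr (- s)) - (powr_primitive s ?a - ?a * ?a powr (- s))) \<le> ?B * norm (?b - ?a)"
  proof (rule field_differentiable_bound[where S = "closed_segment ?a ?b" and f' = "\<lambda>w. w powr (- s) - 1 * ?a powr (- s)"])
    fix w assume w: "w \<in> closed_segment ?a ?b"
    show "((\<lambda>w. powr_primitive s w - w * ?a powr (- s)) has_field_derivative w powr - s - 1 * ?a powr - s) (at w within closed_segment ?a ?b)"
      by (rule has_field_derivative_at_within, intro DERIV_diff has_field_derivative_powr_primitive pos[OF w] DERIV_cmult_right DERIV_ident)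
  qed (use 1 in auto)
  moreover have "norm (?b - ?a) = 1"
    by simp
  moreover have "(powr_primitive s ?b - ?b * ?a powr (- s)) - (powr_primitive s ?a - ?a * ?a powr (- s)) = - zeta_remainder n s"
    by (simp add: zeta_remainder_def powr_minus field_simps) (simp flip: add_divide_distrib)
  ultimately show ?thesis
    by simp
qed

text \<open>Clearing the denominator 1 - s makes one formula valid for all s; at s = 1 both sides
  vanish.\<close>

lemma zeta_remainder_mult:
  "(s - 1) * (1 / of_nat (Suc n) powr s - zeta_remainder n s)
     = of_nat (Suc n) powr (1 - s) - of_nat (Suc (Suc n)) powr (1 - s)"
proof (cases "s = 1")
  case True
  then show ?thesis by (simp del: of_nat_Suc)
next
  case False
  then show ?thesis
    by (simp add: zeta_remainder_def powr_primitive_def divide_simps del: of_nat_Suc) (simp add: algebra_simps)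
qed

lemma holomorphic_of_nat_powr:
  "n > 0 \<Longrightarrow> (\<lambda>s. of_nat n powr (c - s)) holomorphic_on A"
  by (intro holomorphic_intros) auto

text \<open>The singularity at 1 is removable, and the value required there is the derivative at 1
  of (s - 1) times the function. This derivative is ln(n+2) - ln(n+1), exactly what the
  \<open>Ln\<close> branch of \<open>powr_primitive\<close> supplies.\<close>

lemma holomorphic_zeta_integral:
  "(\<lambda>s. 1 / of_nat (Suc n) powr s - zeta_remainder n s) holomorphic_on UNIV"
proof (rule pole_theorem_open_0[where a = 1])
  let ?h = "\<lambda>s::complex. of_nat (Suc n) powr (1 - s) - of_nat (Suc (Suc n)) powr (1 - s)"
  show "?h holomorphic_on UNIV"
    by (intro holomorphic_on_diff holomorphic_of_nat_powr) auto
  show "?h s = (s - 1) * (1 / of_nat (Suc n) powr s - zeta_remainder n s)" for s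
    by (simp only: zeta_remainder_mult)
  have "(deriv ^^ 1) ?h 1 = (deriv ^^ 1) (\<lambda>s. of_nat (Suc n) powr (1 - s)) 1 - (deriv ^^ 1) (\<lambda>s. of_nat (Suc (Suc n)) powr (1 - s)) 1"
    by (rule higher_deriv_diff[where S = UNIV]) (auto intro!: holomorphic_of_nat_powr simp del: of_nat_Suc)
  also have "\<dots> = 1 / of_nat (Suc n) powr 1 - zeta_remainder n 1"
    by (subst (1 2) higher_deriv_of_nat_powr)
      (simp_all add: zeta_remainder_def powr_primitive_def Ln_of_nat del: of_nat_Suc)
  finally show "1 / of_nat (Suc n) powr 1 - zeta_remainder n 1 = deriv ?h 1"
    by simp
qed (auto simp del: of_nat_Suc)

lemma holomorphic_zeta_remainder: "zeta_remainder n holomorphic_on A"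
proof -
  have "(\<lambda>s. of_nat (Suc n) powr (0 - s) - (1 / of_nat (Suc n) powr s - zeta_remainder n s)) holomorphic_on UNIV"
    by (intro holomorphic_on_diff holomorphic_zeta_integral holomorphic_of_nat_powr) auto
  also have "(\<lambda>s. of_nat (Suc n) powr (0 - s) - (1 / of_nat (Suc n) powr s - zeta_remainder n s)) = zeta_remainder n"
    by (simp add: powr_minus_divide fun_eq_iff del: of_nat_Suc)
  finally show ?thesis
    by (rule holomorphic_on_subset) simp
qed

text \<open>
  The derivatives of the integral \<open>g\<close> of \<open>x powr - s\<close> over \<open>[n + 1, n + 2]\<close> at the removable
  singularity \<open>1\<close> are read off from \<open>(s - 1) * g s\<close>.
\<close>
lemma higher_deriv_zeta_remainder_1:
  "(deriv ^^ k) (zeta_remainder n) 1 = (-1) ^ k * of_real (ln (real (Suc n)) ^ k / real (Suc n)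
      - (ln (real (Suc (Suc n))) ^ Suc k - ln (real (Suc n)) ^ Suc k) / real (Suc k))"
proof -
  let ?g = "\<lambda>s. 1 / of_nat (Suc n) powr s - zeta_remainder n s"
  let ?l = "\<lambda>m. complex_of_real (ln (real m))"
  have "(deriv ^^ Suc k) (\<lambda>s. (s - 1) * ?g s) 1 =
      (\<Sum>i=0..Suc k. of_nat (Suc k choose i) * (deriv ^^ i) (\<lambda>s. s - 1) 1 * (deriv ^^ (Suc k - i)) ?g 1)"
    by (rule higher_deriv_mult[where S = UNIV, OF _ holomorphic_zeta_integral]) (auto intro!: holomorphic_intros)
  \<comment> \<open>In the Leibniz sum s - 1 itself vanishes at 1, and so do its derivatives of
    order at least 2; only i = 1 is left, with weight k + 1.\<close>
  also have "\<dots> = (\<Sum>i\<in>{1}. of_nat (Suc k choose i) * (deriv ^^ i) (\<lambda>s. s - 1) 1 * (deriv ^^ (Suc k - i)) ?g 1)"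
  proof (rule sum.mono_neutral_right)
    have "(deriv ^^ i) (\<lambda>s. s - 1) (1 :: complex) = 0" if "i \<noteq> 1" for i
      using higher_deriv_power[of i 1 1 1] that by (cases i) (auto simp: pochhammer_0_left)
    then show "\<forall>i\<in>{0..Suc k} - {1}. of_nat (Suc k choose i) * (deriv ^^ i) (\<lambda>s. s - 1) 1 * (deriv ^^ (Suc k - i)) ?g 1 = 0"
      by auto
  qed auto
  also have "\<dots> = of_nat (Suc k) * (deriv ^^ k) ?g 1"
    by simp
  also have "(\<lambda>s. (s - 1) * ?g s) = (\<lambda>s. of_nat (Suc n) powr (1 - s) - of_nat (Suc (Suc n)) powr (1 - s))"
    by (simp only: zeta_remainder_mult)
  also have "(deriv ^^ Suc k) \<dots> 1 = (deriv ^^ Suc k) (\<lambda>s. of_nat (Suc n) powr (1 - s)) 1 - (deriv ^^ Suc k) (\<lambda>s. of_nat (Suc (Suc n)) powr (1 - s)) 1"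
    by (rule higher_deriv_diff[where S = UNIV]) (auto intro!: holomorphic_of_nat_powr simp del: of_nat_Suc)
  also have "\<dots> = (- ?l (Suc n)) ^ Suc k - (- ?l (Suc (Suc n))) ^ Suc k"
    by (subst (1 2) higher_deriv_of_nat_powr) (simp_all del: of_nat_Suc)
  also have "\<dots> = (-1) ^ k * (?l (Suc (Suc n)) ^ Suc k - ?l (Suc n) ^ Suc k)"
    by (subst (1 2) power_minus) (simp add: algebra_simps del: of_nat_Suc)
  finally have g: "(deriv ^^ k) ?g 1 = (-1) ^ k * (?l (Suc (Suc n)) ^ Suc k - ?l (Suc n) ^ Suc k) / of_nat (Suc k)"
    by (simp add: field_simps del: of_nat_Suc)
  have "(deriv ^^ k) (\<lambda>s. of_nat (Suc n) powr (0 - s) - ?g s) 1 = (deriv ^^ k) (\<lambda>s. of_nat (Suc n) powr (0 - s)) 1 - (deriv ^^ k) ?g 1"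
    by (rule higher_deriv_diff[OF holomorphic_of_nat_powr holomorphic_zeta_integral]) simp_all
  also have "(\<lambda>s. of_nat (Suc n) powr (0 - s) - ?g s) = zeta_remainder n"
    by (simp add: powr_minus_divide fun_eq_iff del: of_nat_Suc)
  also have "(deriv ^^ k) (\<lambda>s. of_nat (Suc n) powr (0 - s)) 1 = (-1) ^ k * (?l (Suc n) ^ k / of_nat (Suc n))"
    by (subst higher_deriv_of_nat_powr) (simp, subst power_minus, simp add: powr_minus_divide del: of_nat_Suc)
  finally show ?thesis
    unfolding g by (simp add: algebra_simps del: of_nat_Suc)
qed

lemma zeta_remainder_bound:
  assumes z: "Re z > 0"
  shows "\<exists>r>0. \<exists>M. cball z r \<subseteq> {s. Re s > 0} \<and> summable M \<and>
           (\<forall>n. \<forall>w\<in>cball z r. norm (zeta_remainder n w) \<le> M n)"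
proof (intro exI conjI allI ballI)
  let ?r = "Re z / 2"
  show "?r > 0" using z by simp
  have Re: "Re w \<ge> ?r" if "w \<in> cball z ?r" for w
    using that complex_Re_le_cmod[of "z - w"] by (simp add: dist_norm)
  show "cball z ?r \<subseteq> {s. Re s > 0}"
    using Re z by force
  \<comment> \<open>The factor \<open>(... + 0) ^ 0\<close> is 1, inserted so that
    \<open>summable_ln_power_powr\<close> applies. On the disc |w| is at most
    \<open>norm z + ?r\<close>.\<close>
  show "summable (\<lambda>n. (norm z + ?r) * ((ln (real (Suc n)) + 0) ^ 0 * real (Suc n) powr - (1 + ?r)))"
    using z by (intro summable_mult summable_ln_power_powr) simp
  fix n w assume w: "w \<in> cball z ?r"
  have "norm (zeta_remainder n w) \<le> norm w * real (Suc n) powr - (1 + Re w)"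
    using Re[OF w] z by (intro norm_zeta_remainder_le) simp
  also have "\<dots> \<le> (norm z + ?r) * real (Suc n) powr - (1 + ?r)"
    using Re[OF w] w z norm_triangle_ineq2[of w z]
    by (intro mult_mono powr_mono) (auto simp: dist_norm norm_minus_commute)
  finally show "norm (zeta_remainder n w) \<le> (norm z + ?r) * ((ln (real (Suc n)) + 0) ^ 0 * real (Suc n) powr - (1 + ?r))"
    by simp
qed

section \<open>The series of (ln n)^k n^-s without its pole, and the Stieltjes constants\<close>

text \<open>On Re s > 1 this is the sum of (ln n)^k n^-s minus k!/(s-1)^(k+1); the sign undoes the
  one in (-ln n)^k.\<close>

definition log_zeta_regular :: "nat \<Rightarrow> complex \<Rightarrow> complex" where
  "log_zeta_regular k s = (-1) ^ k * (deriv ^^ k) (\<lambda>s. \<Sum>n. zeta_remainder n s) s"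

lemma
  shows holomorphic_suminf_zeta_remainder: "(\<lambda>s. \<Sum>n. zeta_remainder n s) holomorphic_on {s. Re s > 0}"
    and higher_deriv_zeta_remainder_sums: "Re z > 0 \<Longrightarrow>
      (\<lambda>n. (deriv ^^ k) (zeta_remainder n) z) sums (deriv ^^ k) (\<lambda>s. \<Sum>n. zeta_remainder n s) z"
proof -
  have op: "open {s. Re s > 0}"
    by (simp add: open_halfspace_Re_gt)
  show "(\<lambda>s. \<Sum>n. zeta_remainder n s) holomorphic_on {s. Re s > 0}"
    by (rule holomorphic_suminf[OF op holomorphic_zeta_remainder]) (rule zeta_remainder_bound, simp)
  show "(\<lambda>n. (deriv ^^ k) (zeta_remainder n) z) sums (deriv ^^ k) (\<lambda>s. \<Sum>n. zeta_remainder n s) z" if "Re z > 0"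
    by (rule higher_deriv_sums[OF op holomorphic_zeta_remainder]) (rule zeta_remainder_bound, use that in simp_all)
qed

lemma holomorphic_log_zeta_regular: "log_zeta_regular k holomorphic_on {s. Re s > 0}"
  unfolding log_zeta_regular_def [abs_def]
  by (intro holomorphic_on_mult holomorphic_on_const holomorphic_higher_deriv holomorphic_suminf_zeta_remainder)
    (simp add: open_halfspace_Re_gt)

text \<open>For Re s > 1 the primitive tends to 0 at infinity, so the telescoped integrals leave
  only the endpoint 1.\<close>

lemma suminf_zeta_remainder:
  assumes s: "Re s > 1"
  shows "(\<Sum>n. zeta_remainder n s) = (\<Sum>n. 1 / of_nat (Suc n) powr s) - 1 / (s - 1)"
proof -
  have "(\<lambda>n. of_nat (Suc n) powr (1 - s) / (1 - s)) \<longlonglongrightarrow> 0"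
  proof (rule tendsto_norm_zero_cancel)
    have "(\<lambda>n. real (Suc n) powr (1 - Re s)) \<longlonglongrightarrow> 0"
      using s by real_asymp
    then have "(\<lambda>n. real (Suc n) powr (1 - Re s) / norm (1 - s)) \<longlonglongrightarrow> 0"
      by (rule tendsto_divide_zero)
    then show "(\<lambda>n. norm (of_nat (Suc n) powr (1 - s) / (1 - s))) \<longlonglongrightarrow> 0"
      by (simp add: norm_divide norm_powr_real_powr del: of_nat_Suc)
  qed
  moreover have s1: "s \<noteq> 1"
    using s by auto
  ultimately have "(\<lambda>n. powr_primitive s (of_nat (Suc n))) \<longlonglongrightarrow> 0"
    by (simp add: powr_primitive_def del: of_nat_Suc)
  then have 1: "(\<lambda>n. powr_primitive s (of_nat (Suc (Suc n))) - powr_primitive s (of_nat (Suc n))) sums (0 - powr_primitive s (of_nat (Suc 0)))"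
    by (rule telescope_sums)
  have "summable (\<lambda>n. 1 / of_nat (Suc n) powr s)"
    using s by (intro summable_dirichlet_series[of "\<lambda>_. 1" 1 0 0 0]) (auto simp del: of_nat_Suc)
  from sums_diff[OF summable_sums[OF this] 1]
  have "(\<lambda>n. zeta_remainder n s) sums ((\<Sum>n. 1 / of_nat (Suc n) powr s) - (0 - powr_primitive s (of_nat (Suc 0))))"
    unfolding zeta_remainder_def .
  moreover have "0 - powr_primitive s (of_nat (Suc 0)) = 1 / (s - 1)"
    using s1 by (simp add: powr_primitive_def field_simps)
  ultimately show ?thesis
    by (metis sums_unique)
qed

lemma higher_deriv_inverse_shift:
  assumes "s \<noteq> (a :: complex)"
  shows "(deriv ^^ k) (\<lambda>s. 1 / (s - a)) s = (-1) ^ k * fact k / (s - a) ^ Suc k"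
  using assms
proof (induction k arbitrary: s)
  case (Suc k)
  have "eventually (\<lambda>s. s \<noteq> a) (nhds s)"
    using Suc.prems by (rule t1_space_nhds)
  then have "eventually (\<lambda>s. (deriv ^^ k) (\<lambda>s. 1 / (s - a)) s = (-1) ^ k * fact k / (s - a) ^ Suc k) (nhds s)"
    by eventually_elim (rule Suc.IH)
  then have "(deriv ^^ Suc k) (\<lambda>s. 1 / (s - a)) s = deriv (\<lambda>s. (-1) ^ k * fact k / (s - a) ^ Suc k) s"
    by (simp add: deriv_cong_ev)
  also have "((\<lambda>s. (-1) ^ k * fact k / (s - a) ^ Suc k) has_field_derivative
      (-1) ^ Suc k * fact (Suc k) / (s - a) ^ Suc (Suc k)) (at s)"
    using Suc.prems by (auto intro!: derivative_eq_intros simp: divide_simps) (cases k; simp add: algebra_simps)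
  then have "deriv (\<lambda>s. (-1) ^ k * fact k / (s - a) ^ Suc k) s = (-1) ^ Suc k * fact (Suc k) / (s - a) ^ Suc (Suc k)"
    by (rule DERIV_imp_deriv)
  finally show ?case .
qed simp

text \<open>Obtained by differentiating \<open>suminf_zeta_remainder\<close> k times, which is
  allowed since it holds on an open half-plane.\<close>

lemma log_zeta_regular_plus_pole:
  assumes s: "Re s > 1"
  shows "(\<lambda>n. of_real (ln (real (Suc n)) ^ k) / of_nat (Suc n) powr s) sums
    (log_zeta_regular k s + fact k / (s - 1) ^ Suc k)"
proof -
  let ?Z = "\<lambda>s. \<Sum>n. 1 / of_nat (Suc n) powr s :: complex"
  have op: "open {s. Re s > 1}"
    by (simp add: open_halfspace_Re_gt)
  have a: "norm (1 :: complex) \<le> 1 * (ln (real (Suc n)) + 0) ^ 0 / real (Suc n) powr 0" for n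
    by (simp del: of_nat_Suc)
  have holZ: "?Z holomorphic_on {s. Re s > 1}"
    using holomorphic_dirichlet_series[OF a] by simp
  have "(deriv ^^ k) (\<lambda>s. \<Sum>n. zeta_remainder n s) s = (deriv ^^ k) (\<lambda>s. ?Z s - 1 / (s - 1)) s"
    using holomorphic_suminf_zeta_remainder
    by (rule higher_deriv_transform_within_open[OF holomorphic_on_subset _ op])
       (use s in \<open>auto simp: suminf_zeta_remainder intro!: holZ holomorphic_intros simp del: of_nat_Suc\<close>)
  also have "\<dots> = (deriv ^^ k) ?Z s - (deriv ^^ k) (\<lambda>s. 1 / (s - 1)) s"
    by (rule higher_deriv_diff[OF holZ _ op]) (use s in \<open>auto intro!: holomorphic_intros\<close>)
  also have "(deriv ^^ k) (\<lambda>s. 1 / (s - 1)) s = (-1) ^ k * fact k / (s - 1) ^ Suc k"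
    using s by (intro higher_deriv_inverse_shift) auto
  finally have D: "(deriv ^^ k) (\<lambda>s. \<Sum>n. zeta_remainder n s) s = (deriv ^^ k) ?Z s - (-1) ^ k * fact k / (s - 1) ^ Suc k" .
  have eq: "log_zeta_regular k s + fact k / (s - 1) ^ Suc k = (-1) ^ k * (deriv ^^ k) ?Z s"
    unfolding log_zeta_regular_def D by (cases "even k") (simp_all del: of_nat_Suc power_Suc)
  have "(\<lambda>n. (deriv ^^ k) (\<lambda>s. 1 / of_nat (Suc n) powr s) s) sums (deriv ^^ k) ?Z s"
    using higher_deriv_dirichlet_series_sums[OF a] s by simp
  moreover have "(\<lambda>s. 1 / of_nat (Suc n) powr s) = (\<lambda>s. complex_of_nat (Suc n) powr (0 - s))" for n
    by (simp add: powr_minus_divide del: of_nat_Suc)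
  ultimately have "(\<lambda>n. (- of_real (ln (real (Suc n)))) ^ k * of_nat (Suc n) powr (0 - s)) sums (deriv ^^ k) ?Z s"
    by (simp add: higher_deriv_of_nat_powr del: of_nat_Suc diff_0)
  then have "(\<lambda>n. (-1) ^ k * ((- of_real (ln (real (Suc n)))) ^ k * of_nat (Suc n) powr (0 - s))) sums ((-1) ^ k * (deriv ^^ k) ?Z s)"
    by (rule sums_mult)
  moreover have "(-1) ^ k * ((- of_real (ln (real (Suc n)))) ^ k * of_nat (Suc n) powr (0 - s))
     = of_real (ln (real (Suc n)) ^ k) / of_nat (Suc n) powr s" for n
    by (subst power_minus) (simp add: powr_minus_divide del: of_nat_Suc flip: mult.assoc power_mult_distrib)
  ultimately show ?thesis
    by (simp add: eq del: of_nat_Suc power_Suc)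
qed

lemma stieltjes_LIMSEQ:
  "(\<lambda>N. (\<Sum>j=1..N. ln (real j) ^ k / real j) - ln (real N) ^ (k + 1) / real (k + 1)) \<longlonglongrightarrow> stieltjes k"
  and log_zeta_regular_1: "log_zeta_regular k 1 = of_real (stieltjes k)"
proof -
  let ?b = "\<lambda>n. ln (real (Suc n)) ^ k / real (Suc n)"
  let ?L = "\<lambda>n. ln (real (Suc n)) ^ Suc k / real (Suc k)"
  let ?S = "\<lambda>N. (\<Sum>j=1..N. ln (real j) ^ k / real j) - ln (real N) ^ (k + 1) / real (k + 1)"
  have "(\<lambda>n. (-1) ^ k * (deriv ^^ k) (zeta_remainder n) 1) sums log_zeta_regular k 1"
    unfolding log_zeta_regular_def by (intro sums_mult higher_deriv_zeta_remainder_sums) simp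
  then have "(\<lambda>n. complex_of_real (?b n - (?L (Suc n) - ?L n))) sums log_zeta_regular k 1"
    by (simp add: higher_deriv_zeta_remainder_1 diff_divide_distrib del: of_nat_Suc flip: mult.assoc power_mult_distrib)
  then have c: "(\<lambda>N. complex_of_real (\<Sum>n<N. ?b n - (?L (Suc n) - ?L n))) \<longlonglongrightarrow> log_zeta_regular k 1"
    by (simp add: sums_def del: of_nat_Suc)
  \<comment> \<open>All partial sums are real, hence so is the limit; this is needed because
    \<open>stieltjes\<close> is a real limit.\<close>
  define E where "E = Re (log_zeta_regular k 1)"
  have "Im (log_zeta_regular k 1) = 0"
    using tendsto_Im[OF c] by (simp add: LIMSEQ_const_iff del: of_nat_Suc)
  then have E: "log_zeta_regular k 1 = of_real E"
    by (simp add: E_def complex_eq_iff)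
  have s: "(\<lambda>n. ?b n - (?L (Suc n) - ?L n)) sums E"
    using tendsto_Re[OF c] by (simp add: sums_def E_def del: of_nat_Suc)
  \<comment> \<open>N + 1 terms are compared with an integral reaching up to N + 2, whereas
    \<open>stieltjes\<close> stops it at N + 1. The last bracket corrects this and tends to
    0.\<close>
  have part: "(\<Sum>n<Suc N. ?b n - (?L (Suc n) - ?L n)) = ?S (Suc N) - (?L (Suc N) - ?L N)" for N
  proof -
    have "(\<Sum>n<Suc N. ?L (Suc n) - ?L n) = ?L (Suc N) - ?L 0"
      by (rule sum_lessThan_telescope)
    moreover have "(\<Sum>n<Suc N. ?b n) = (\<Sum>j=1..Suc N. ln (real j) ^ k / real j)"
      by (rule sum.reindex_bij_witness[of _ "\<lambda>j. j - 1" Suc]) auto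
    ultimately show ?thesis
      by (simp add: sum_subtractf del: of_nat_Suc sum.lessThan_Suc)
  qed
  have "?b \<longlonglongrightarrow> 0"
    by real_asymp
  moreover have "(\<lambda>n. ?b n - (?L (Suc n) - ?L n)) \<longlonglongrightarrow> 0"
    using s by (intro summable_LIMSEQ_zero sums_summable)
  ultimately have "(\<lambda>n. ?L (Suc n) - ?L n) \<longlonglongrightarrow> 0"
    using tendsto_diff by fastforce
  moreover have "(\<lambda>N. \<Sum>n<Suc N. ?b n - (?L (Suc n) - ?L n)) \<longlonglongrightarrow> E"
    using s unfolding sums_def by (rule LIMSEQ_Suc)
  ultimately have "(\<lambda>N. (\<Sum>n<Suc N. ?b n - (?L (Suc n) - ?L n)) + (?L (Suc N) - ?L N)) \<longlonglongrightarrow> E + 0"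
    by (intro tendsto_add)
  then have "(\<lambda>N. ?S (Suc N)) \<longlonglongrightarrow> E"
    unfolding part diff_add_cancel add_0_right .
  then have lim: "?S \<longlonglongrightarrow> E"
    by (rule LIMSEQ_imp_Suc)
  then have "stieltjes k = E"
    unfolding stieltjes_def by (rule limI)
  then show "?S \<longlonglongrightarrow> stieltjes k" "log_zeta_regular k 1 = of_real (stieltjes k)"
    using lim E by simp_all
qed

text \<open>The term j = 1 counts fully because (ln 1)^0 = 0^0 = 1.\<close>

lemma stieltjes_0: "stieltjes 0 = euler_mascheroni"
proof -
  have "(\<lambda>N. (\<Sum>j=1..N. ln (real j) ^ 0 / real j) - ln (real N) ^ (0 + 1) / real (0 + 1)) = (\<lambda>N. harm N - ln (real N))"
    by (simp add: harm_def divide_inverse)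
  with stieltjes_LIMSEQ[of 0] euler_mascheroni_LIMSEQ show ?thesis
    by (auto intro: LIMSEQ_unique)
qed

section \<open>Harmonic numbers against ln n + gamma\<close>

text \<open>With N = n + 1, H_N - ln N decreases to gamma while H_N - ln(N+1) stays below gamma, and
  the two differ by at most 1/N.\<close>

lemma harm_minus_ln_bounds:
  "harm (Suc n) - (ln (real (Suc n)) + euler_mascheroni) \<in> {0..1 / real (Suc n)}"
proof -
  have "euler_mascheroni \<le> harm (Suc n) - ln (real (Suc n))"
    using decseq_ge[OF decseq_harm_diff_ln LIMSEQ_Suc[OF euler_mascheroni_LIMSEQ], of n] by simp
  moreover have "harm (Suc n) - ln (real (n + 2)) \<le> euler_mascheroni"
    using order_trans[OF _ euler_mascheroni_lower[of n], of "harm (Suc n) - ln (real (n + 2))"] by simp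
  moreover have "ln (real (n + 2)) - ln (real (Suc n)) \<le> 1 / real (Suc n)"
  proof -
    have "1 + 1 / real (Suc n) = real (n + 2) / real (Suc n)"
      by (simp add: field_simps)
    then show ?thesis
      using ln_add_one_self_le_self[of "1 / real (Suc n)"] ln_div[of "real (n + 2)" "real (Suc n)"]
      by (simp del: of_nat_Suc)
  qed
  ultimately show ?thesis
    by auto
qed

lemma norm_harm_power_le:
  "norm (harm (Suc n) ^ j :: complex) \<le> 1 * (ln (real (Suc n)) + (euler_mascheroni + 1)) ^ j / real (Suc n) powr 0"
proof -
  have "1 / real (Suc n) \<le> 1"
    by simp
  then have "harm (Suc n) \<le> ln (real (Suc n)) + (euler_mascheroni + 1)"
    using harm_minus_ln_bounds[of n] unfolding atLeastAtMost_iff by linarith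
  then have "harm (Suc n) ^ j \<le> (ln (real (Suc n)) + (euler_mascheroni + 1)) ^ j"
    by (intro power_mono harm_nonneg)
  then show ?thesis
    by (simp add: norm_power norm_harm del: of_nat_Suc)
qed

text \<open>Factoring a^m - b^m leaves m products of m - 1 factors, each factor at most ln(n+1) +
  gamma + 1. For m = 0 both sides are 0.\<close>

lemma abs_harm_power_diff_le:
  "\<bar>harm (Suc n) ^ m - (ln (real (Suc n)) + euler_mascheroni) ^ m\<bar>
     \<le> real m * (ln (real (Suc n)) + (euler_mascheroni + 1)) ^ (m - 1) / real (Suc n)"
proof (cases m)
  case (Suc q)
  define H L where "H = (harm (Suc n) :: real)" and "L = ln (real (Suc n)) + euler_mascheroni"
  have HL: "0 \<le> H - L" "H - L \<le> 1 / real (Suc n)" "0 \<le> L"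
    using harm_minus_ln_bounds[of n] euler_mascheroni_pos by (auto simp: H_def L_def)
  have "H - L \<le> 1"
    using HL(2) by (rule order_trans) simp
  then have le: "H \<le> L + 1" by simp
  have "\<bar>H ^ m - L ^ m\<bar> = (H - L) * (\<Sum>p<Suc q. H ^ p * L ^ (q - p))"
    unfolding Suc diff_power_eq_sum using HL
    by (intro abs_of_nonneg mult_nonneg_nonneg sum_nonneg zero_le_power) auto
  also have "\<dots> \<le> 1 / real (Suc n) * (\<Sum>p<Suc q. (L + 1) ^ q)"
  proof (intro mult_mono sum_mono HL)
    fix p assume "p \<in> {..<Suc q}"
    then have "(L + 1) ^ q = (L + 1) ^ p * (L + 1) ^ (q - p)"
      by (simp flip: power_add)
    also have "\<dots> \<ge> H ^ p * L ^ (q - p)"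
      using HL le by (intro mult_mono power_mono) auto
    finally show "H ^ p * L ^ (q - p) \<le> (L + 1) ^ q" .
  qed (use HL in \<open>auto intro!: sum_nonneg mult_nonneg_nonneg zero_le_power simp del: sum.lessThan_Suc\<close>)
  finally show ?thesis
    by (simp add: Suc H_def L_def add_ac)
qed simp

definition harm_log_diff :: "nat \<Rightarrow> nat \<Rightarrow> real" where
  "harm_log_diff m n = harm (Suc n) ^ m - (ln (real (Suc n)) + euler_mascheroni) ^ m"

lemma norm_harm_log_diff_le:
  "norm (complex_of_real (harm_log_diff m n))
     \<le> real m * (ln (real (Suc n)) + (euler_mascheroni + 1)) ^ (m - 1) / real (Suc n) powr 1"
  using abs_harm_power_diff_le[of n m] unfolding norm_of_real harm_log_diff_def by simp

lemma harm_log_diff_LIMSEQ: "harm_log_diff m \<longlonglongrightarrow> 0"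
proof -
  let ?x = "\<lambda>n. (ln (real (Suc n)) + (euler_mascheroni + 1)) ^ (m - 1) / real (Suc n)"
  \<comment> \<open>The squares of \<open>?x\<close> are summable, hence tend to 0, and so does
    \<open>?x\<close>.\<close>
  have "summable (\<lambda>n. (ln (real (Suc n)) + (euler_mascheroni + 1)) ^ (2 * (m - 1)) * real (Suc n) powr - (1 + 1))"
    by (rule summable_ln_power_powr) simp
  also have "(\<lambda>n. (ln (real (Suc n)) + (euler_mascheroni + 1)) ^ (2 * (m - 1)) * real (Suc n) powr - (1 + 1)) = (\<lambda>n. ?x n ^ 2)"
    by (simp add: power_divide powr_minus_divide mult.commute flip: power_mult del: of_nat_Suc)
  finally have "?x \<longlonglongrightarrow> 0"
    using power_tendsto_0_iff[of 2 ?x sequentially] by (auto dest: summable_LIMSEQ_zero)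
  then have "(\<lambda>n. real m * ?x n) \<longlonglongrightarrow> 0"
    by (rule tendsto_mult_right_zero)
  then show ?thesis
    by (rule Lim_null_comparison[rotated])
      (use abs_harm_power_diff_le[of _ m] in \<open>simp add: harm_log_diff_def del: of_nat_Suc\<close>)
qed

section \<open>Continuation of the harmonic zeta function and its constant term at 1\<close>

text \<open>H_n^m is its deviation from (ln n + gamma)^m plus the binomial expansion of that power.
  Each (ln n)^k contributes its pole-free series here and its pole in
  \<open>harm_zeta_polar\<close>.\<close>

definition harm_zeta_regular :: "nat \<Rightarrow> complex \<Rightarrow> complex" where
  "harm_zeta_regular m s = (\<Sum>n. of_real (harm_log_diff m n) / of_nat (Suc n) powr s)
     + (\<Sum>k=0..m. of_nat (m choose k) * euler_mascheroni ^ (m - k) * log_zeta_regular k s)"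

definition harm_zeta_polar :: "nat \<Rightarrow> complex \<Rightarrow> complex" where
  "harm_zeta_polar m s =
     (\<Sum>k=0..m. of_nat (m choose k) * euler_mascheroni ^ (m - k) * (fact k / (s - 1) ^ Suc k))"

lemma holomorphic_harm_zeta_regular: "harm_zeta_regular m holomorphic_on {s. Re s > 0}"
proof -
  have "(\<lambda>s. \<Sum>n. of_real (harm_log_diff m n) / of_nat (Suc n) powr s) holomorphic_on {s. Re s > 0}"
    using holomorphic_dirichlet_series[OF norm_harm_log_diff_le] by simp
  then show ?thesis
    unfolding harm_zeta_regular_def [abs_def]
    by (intro holomorphic_on_add holomorphic_on_sum holomorphic_on_mult holomorphic_on_const
        holomorphic_log_zeta_regular)
qed

lemma harm_dirichlet_series_eq:
  assumes s: "Re s > 1"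
  shows "(\<Sum>n. harm (Suc n) ^ m / of_nat (Suc n) powr s) = harm_zeta_regular m s + harm_zeta_polar m s"
proof -
  let ?c = "\<lambda>k. of_nat (m choose k) * euler_mascheroni ^ (m - k) :: complex"
  have "summable (\<lambda>n. of_real (harm_log_diff m n) / of_nat (Suc n) powr s)"
    using s by (intro summable_dirichlet_series[OF norm_harm_log_diff_le]) simp
  then have 1: "(\<lambda>n. of_real (harm_log_diff m n) / of_nat (Suc n) powr s) sums
      (\<Sum>n. of_real (harm_log_diff m n) / of_nat (Suc n) powr s)"
    by (rule summable_sums)
  have 2: "(\<lambda>n. \<Sum>k=0..m. ?c k * (of_real (ln (real (Suc n)) ^ k) / of_nat (Suc n) powr s)) sums
      (\<Sum>k=0..m. ?c k * (log_zeta_regular k s + fact k / (s - 1) ^ Suc k))"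
    by (intro sums_sum sums_mult log_zeta_regular_plus_pole s)
  have "of_real (harm_log_diff m n) / of_nat (Suc n) powr s +
      (\<Sum>k=0..m. ?c k * (of_real (ln (real (Suc n)) ^ k) / of_nat (Suc n) powr s))
      = harm (Suc n) ^ m / of_nat (Suc n) powr s" for n
  proof -
    have "(of_real (ln (real (Suc n))) + euler_mascheroni) ^ m = (\<Sum>k=0..m. ?c k * of_real (ln (real (Suc n)) ^ k))"
      by (simp add: binomial_ring atLeast0AtMost mult_ac del: of_nat_Suc)
    then have "complex_of_real (harm_log_diff m n) = harm (Suc n) ^ m - (\<Sum>k=0..m. ?c k * of_real (ln (real (Suc n)) ^ k))"
      by (simp add: harm_log_diff_def of_real_harm del: of_nat_Suc)
    then show ?thesis
      by (simp add: diff_divide_distrib sum_divide_distrib del: of_nat_Suc)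
  qed
  with sums_add[OF 1 2] have S: "(\<lambda>n. harm (Suc n) ^ m / of_nat (Suc n) powr s) sums
    ((\<Sum>n. of_real (harm_log_diff m n) / of_nat (Suc n) powr s) +
     (\<Sum>k=0..m. ?c k * (log_zeta_regular k s + fact k / (s - 1) ^ Suc k)))"
    by simp
  have eq: "(\<Sum>k=0..m. ?c k * (log_zeta_regular k s + fact k / (s - 1) ^ Suc k)) =
    (\<Sum>k=0..m. ?c k * log_zeta_regular k s) + harm_zeta_polar m s"
    unfolding harm_zeta_polar_def by (simp only: distrib_left sum.distrib)
  show ?thesis
    unfolding harm_zeta_regular_def sums_unique[OF S, symmetric] eq by (simp only: add.assoc)
qed

lemma meromorphic_harm_zeta_continuation:
  "(\<lambda>s. harm_zeta_regular m s + harm_zeta_polar m s) meromorphic_on {s. Re s > 0}"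
proof -
  have "harm_zeta_regular m analytic_on {s. Re s > 0}"
    using holomorphic_harm_zeta_regular by (simp add: analytic_on_open open_halfspace_Re_gt)
  then have "harm_zeta_regular m meromorphic_on {s. Re s > 0}"
    by (rule analytic_on_imp_meromorphic_on)
  moreover have "harm_zeta_polar m meromorphic_on {s. Re s > 0}"
    unfolding harm_zeta_polar_def [abs_def]
    by (intro meromorphic_intros analytic_on_imp_meromorphic_on[of "\<lambda>s. s - 1"] analytic_intros)
  ultimately show ?thesis
    by (intro meromorphic_intros)
qed

text \<open>The explicit function is a witness for the choice in
  \<open>dirichlet_continuation\<close>, so the chosen function has the defining properties.\<close>

lemma
  shows meromorphic_harm_zeta: "harm_zeta m meromorphic_on {s. Re s > 0}"
    and harm_zeta_eq: "Re s > 1 \<Longrightarrow> harm_zeta m s = (\<Sum>n. harm (Suc n) ^ m / of_nat (Suc n) powr s)"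
proof -
  let ?P = "\<lambda>F. F meromorphic_on {s. Re s > 0} \<and>
    (\<forall>s. Re s > 1 \<longrightarrow> F s = (\<Sum>n. harm (Suc n) ^ m / of_nat (Suc n) powr s))"
  have "?P (\<lambda>s. harm_zeta_regular m s + harm_zeta_polar m s)"
    by (simp add: meromorphic_harm_zeta_continuation harm_dirichlet_series_eq del: of_nat_Suc)
  then have "?P (harm_zeta m)"
    unfolding harm_zeta_def dirichlet_continuation_def by (rule someI[where P = ?P])
  then show "harm_zeta m meromorphic_on {s. Re s > 0}"
    "Re s > 1 \<Longrightarrow> harm_zeta m s = (\<Sum>n. harm (Suc n) ^ m / of_nat (Suc n) powr s)"
    by blast+
qed

text \<open>Identity principle on the connected set Re s > 0: a meromorphic difference is zero off a
  sparse set or nonzero off a sparse set. Equality at 1 itself is not claimed, since the choice is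
  free there.\<close>

lemma harm_zeta_eventually_eq:
  "eventually (\<lambda>s. harm_zeta m s = harm_zeta_regular m s + harm_zeta_polar m s) (at 1)"
proof -
  let ?A = "{s. Re s > 0}"
  let ?f = "\<lambda>s. harm_zeta m s - (harm_zeta_regular m s + harm_zeta_polar m s)"
  have A: "open ?A" "connected ?A" "1 \<in> ?A" "2 \<in> ?A"
    by (auto simp: open_halfspace_Re_gt convex_halfspace_Re_gt intro!: convex_connected)
  have "?f meromorphic_on ?A"
    by (intro meromorphic_on_diff meromorphic_harm_zeta meromorphic_harm_zeta_continuation)
  then have "eventually (\<lambda>z. ?f z = 0) (cosparse ?A) \<or> eventually (\<lambda>z. ?f z \<noteq> 0) (cosparse ?A)"
    by (rule meromorphic_imp_constant_or_avoid) (use A in auto)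
  \<comment> \<open>The point 2 has a neighbourhood inside Re s > 1, where both functions equal the
    Dirichlet series.\<close>
  moreover have "\<not> eventually (\<lambda>z. ?f z \<noteq> 0) (cosparse ?A)"
  proof
    assume "eventually (\<lambda>z. ?f z \<noteq> 0) (cosparse ?A)"
    then have "eventually (\<lambda>z. ?f z \<noteq> 0) (at 2)"
      using A by (auto simp: eventually_cosparse_open_eq)
    moreover have "eventually (\<lambda>z. z \<in> {z. Re z > 1}) (at 2)"
      by (intro eventually_at_in_open' open_halfspace_Re_gt) auto
    ultimately have "eventually (\<lambda>_. False) (at (2::complex))"
      by eventually_elim (simp add: harm_zeta_eq harm_dirichlet_series_eq del: of_nat_Suc)
    then show False
      by simp
  qed
  ultimately have "eventually (\<lambda>z. ?f z = 0) (at 1)"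
    using A by (auto simp: eventually_cosparse_open_eq)
  then show ?thesis
    by simp
qed

text \<open>The polar part has only negative powers of s - 1, so the constant term is the value of
  the regular part. Agreement in a punctured neighbourhood fixes the Laurent expansion.\<close>

lemma harm_stieltjes_0: "harm_stieltjes m 0 = harm_zeta_regular m 1"
proof -
  let ?c = "\<lambda>k. of_nat (m choose k) * euler_mascheroni ^ (m - k) * fact k :: complex"
  have "harm_zeta_regular m analytic_on {1}"
    unfolding analytic_at using holomorphic_harm_zeta_regular open_halfspace_Re_gt[of 0]
    by (intro exI[of _ "{s. Re s > 0}"]) simp
  then have reg: "(\<lambda>x. harm_zeta_regular m (1 + x)) has_laurent_expansion fps_to_fls (fps_expansion (harm_zeta_regular m) 1)"
    by (intro has_laurent_expansion_fps analytic_at_imp_has_fps_expansion)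
  have "(\<lambda>x. \<Sum>k=0..m. ?c k * x powi (- int (Suc k))) has_laurent_expansion (\<Sum>k=0..m. fls_const (?c k) * fls_X_intpow (- int (Suc k)))"
    by (intro laurent_expansion_intros)
  also have "(\<lambda>x. \<Sum>k=0..m. ?c k * x powi (- int (Suc k))) = (\<lambda>x. harm_zeta_polar m (1 + x))"
    by (simp add: harm_zeta_polar_def power_int_minus field_simps del: of_nat_Suc power_Suc)
  finally have "(\<lambda>x. harm_zeta_regular m (1 + x) + harm_zeta_polar m (1 + x)) has_laurent_expansion
      fps_to_fls (fps_expansion (harm_zeta_regular m) 1) + (\<Sum>k=0..m. fls_const (?c k) * fls_X_intpow (- int (Suc k)))"
    by (intro has_laurent_expansion_add reg)
  then have "laurent_expansion (\<lambda>s. harm_zeta_regular m s + harm_zeta_polar m s) 1 =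
      fps_to_fls (fps_expansion (harm_zeta_regular m) 1) + (\<Sum>k=0..m. fls_const (?c k) * fls_X_intpow (- int (Suc k)))"
    by (rule laurent_expansion_eqI)
  also have "laurent_expansion (\<lambda>s. harm_zeta_regular m s + harm_zeta_polar m s) 1 = laurent_expansion (harm_zeta m) 1"
    by (rule laurent_expansion_cong[OF _ refl], use harm_zeta_eventually_eq[of m] in eventually_elim) simp
  finally show ?thesis
    by (simp add: harm_stieltjes_def fls_nth_sum fps_expansion_def)
qed

text \<open>The series of deviations still converges at s = 1, so its contribution to the constant
  term is the series itself; the other contributions are Stieltjes constants.\<close>

lemma
  shows summable_harm_log_diff: "summable (\<lambda>n. harm_log_diff m n / real (Suc n))"
    and suminf_harm_log_diff: "complex_of_real (\<Sum>n. harm_log_diff m n / real (Suc n)) =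
      harm_stieltjes m 0 - (\<Sum>k=0..m. of_nat (m choose k) * euler_mascheroni ^ (m - k) * of_real (stieltjes k))"
proof -
  have "summable (\<lambda>n. complex_of_real (harm_log_diff m n) / of_nat (Suc n) powr 1)"
    by (intro summable_dirichlet_series[OF norm_harm_log_diff_le]) simp
  then have "summable (\<lambda>n. complex_of_real (harm_log_diff m n / real (Suc n)))"
    by (simp del: of_nat_Suc)
  then show *: "summable (\<lambda>n. harm_log_diff m n / real (Suc n))"
    by (simp only: summable_complex_of_real)
  have "complex_of_real (\<Sum>n. harm_log_diff m n / real (Suc n)) = (\<Sum>n. of_real (harm_log_diff m n) / of_nat (Suc n) powr 1)"
    using suminf_of_real[OF *, where 'a = complex] by (simp del: of_nat_Suc)
  then show "complex_of_real (\<Sum>n. harm_log_diff m n / real (Suc n)) =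
      harm_stieltjes m 0 - (\<Sum>k=0..m. of_nat (m choose k) * euler_mascheroni ^ (m - k) * of_real (stieltjes k))"
    by (simp add: harm_stieltjes_0 harm_zeta_regular_def log_zeta_regular_1 del: of_nat_Suc)
qed

section \<open>Second evaluation of the series by telescoping\<close>

text \<open>The value of \<open>harm_zeta j\<close> at an integer p >= 2, kept real so that the
  limit argument below stays in the reals.\<close>

definition harm_sum :: "nat \<Rightarrow> nat \<Rightarrow> real" where
  "harm_sum j p = (\<Sum>n. harm (Suc n) ^ j / real (Suc n) ^ p)"

lemma
  assumes p: "p \<ge> 2"
  shows harm_sum_sums: "(\<lambda>n. harm (Suc n) ^ j / real (Suc n) ^ p) sums harm_sum j p"
    and of_real_harm_sum: "of_real (harm_sum j p) = harm_zeta j (of_nat p)"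
proof -
  have "summable (\<lambda>n. harm (Suc n) ^ j / of_nat (Suc n) powr complex_of_nat p)"
    using p by (intro summable_dirichlet_series[OF norm_harm_power_le]) simp
  moreover have eq: "harm (Suc n) ^ j / of_nat (Suc n) powr complex_of_nat p
      = complex_of_real (harm (Suc n) ^ j / real (Suc n) ^ p)" for n
    by (simp add: powr_nat of_real_harm del: of_nat_Suc)
  ultimately have "summable (\<lambda>n. complex_of_real (harm (Suc n) ^ j / real (Suc n) ^ p))"
    by simp
  then have *: "summable (\<lambda>n. harm (Suc n) ^ j / real (Suc n) ^ p)"
    by (simp only: summable_complex_of_real)
  then show "(\<lambda>n. harm (Suc n) ^ j / real (Suc n) ^ p) sums harm_sum j p"
    unfolding harm_sum_def by (rule summable_sums)
  show "of_real (harm_sum j p) = harm_zeta j (of_nat p)"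
    unfolding harm_sum_def suminf_of_real[OF *] using p by (subst harm_zeta_eq) (simp_all only: eq, simp)
qed

lemma harm_power_div_telescope:
  "harm (Suc n) ^ m / real (Suc n) = (harm (Suc n) ^ Suc m - harm n ^ Suc m) / real (Suc m)
     + (\<Sum>i<m. real (Suc m choose i) * (-1) ^ (Suc m - i) * (harm (Suc n) ^ i / real (Suc n) ^ (Suc m - i))) / real (Suc m)"
proof -
  let ?H = "harm (Suc n) :: real" and ?N = "real (Suc n)"
  have "harm n = ?H + - (1 / ?N)"
    by (simp add: harm_Suc divide_inverse)
  then have "harm n ^ Suc m = (\<Sum>i\<le>Suc m. real (Suc m choose i) * ?H ^ i * (- (1 / ?N)) ^ (Suc m - i))"
    by (simp only: binomial_ring)
  \<comment> \<open>The two top indices are split off: i = m + 1 telescopes and i = m is the wanted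
    term. For i < m the exponent of 1/(n+1) is at least 2, so those sums converge.\<close>
  also have "\<dots> = ?H ^ Suc m - real (Suc m) * (?H ^ m / ?N) + (\<Sum>i<m. real (Suc m choose i) * ?H ^ i * (- (1 / ?N)) ^ (Suc m - i))"
    by (simp add: lessThan_Suc_atMost [symmetric] del: of_nat_Suc power_Suc binomial_Suc_Suc)
  also have "(\<Sum>i<m. real (Suc m choose i) * ?H ^ i * (- (1 / ?N)) ^ (Suc m - i)) =
      (\<Sum>i<m. real (Suc m choose i) * (-1) ^ (Suc m - i) * (?H ^ i / ?N ^ (Suc m - i)))"
    by (intro sum.cong refl, subst power_minus) (simp add: power_divide del: of_nat_Suc power_Suc binomial_Suc_Suc)
  finally have eq: "harm n ^ Suc m = ?H ^ Suc m - real (Suc m) * (?H ^ m / ?N)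
      + (\<Sum>i<m. real (Suc m choose i) * (-1) ^ (Suc m - i) * (?H ^ i / ?N ^ (Suc m - i)))" .
  show ?thesis
    unfolding eq by (simp add: diff_divide_distrib add_divide_distrib del: of_nat_Suc power_Suc binomial_Suc_Suc)
qed

text \<open>This is the integral of (x + g)^m over [0, l], expanded termwise. It gathers the
  subtracted logarithms of all the Stieltjes limits into one power.\<close>

lemma sum_binomial_div_Suc:
  fixes l g :: real
  shows "(\<Sum>k=0..m. real (m choose k) * g ^ (m - k) * (l ^ Suc k / real (Suc k))) = ((l + g) ^ Suc m - g ^ Suc m) / real (Suc m)"
proof -
  have "real (m choose k) / real (Suc k) = real (Suc m choose Suc k) / real (Suc m)" for k
  proof -
    have "real (Suc k) * real (Suc m choose Suc k) = real (Suc m) * real (m choose k)"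
      by (simp only: of_nat_mult [symmetric] Suc_times_binomial)
    then show ?thesis
      by (simp add: field_simps del: of_nat_Suc binomial_Suc_Suc)
  qed
  then have "(\<Sum>k=0..m. real (m choose k) * g ^ (m - k) * (l ^ Suc k / real (Suc k)))
    = (\<Sum>k=0..m. (real (Suc m choose Suc k) / real (Suc m)) * g ^ (m - k) * l ^ Suc k)"
    by (intro sum.cong refl) (metis (no_types, lifting) times_divide_eq_right times_divide_eq_left mult.commute mult.left_commute)
  also have "\<dots> = (\<Sum>k\<le>m. real (Suc m choose Suc k) * l ^ Suc k * g ^ (Suc m - Suc k)) / real (Suc m)"
    unfolding sum_divide_distrib atLeast0AtMost by (intro sum.cong refl) (simp add: mult_ac del: of_nat_Suc power_Suc binomial_Suc_Suc)
  also have "(l + g) ^ Suc m = g ^ Suc m + (\<Sum>k\<le>m. real (Suc m choose Suc k) * l ^ Suc k * g ^ (Suc m - Suc k))"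
    unfolding binomial_ring sum.atMost_Suc_shift[of _ m] by simp
  then have "(\<Sum>k\<le>m. real (Suc m choose Suc k) * l ^ Suc k * g ^ (Suc m - Suc k)) = (l + g) ^ Suc m - g ^ Suc m"
    by simp
  finally show ?thesis .
qed

lemma harm_log_diff_sums:
  "(\<lambda>n. harm_log_diff m n / real (Suc n)) sums
     (euler_mascheroni ^ Suc m / real (Suc m)
      + (\<Sum>i<m. real (Suc m choose i) * (-1) ^ (Suc m - i) * harm_sum i (Suc m - i)) / real (Suc m)
      - (\<Sum>k=0..m. real (m choose k) * euler_mascheroni ^ (m - k) * stieltjes k))"
proof -
  let ?c = "\<lambda>k. real (m choose k) * euler_mascheroni ^ (m - k)"
  let ?b = "\<lambda>i. real (Suc m choose i) * (-1) ^ (Suc m - i)"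
  let ?S = "\<lambda>k N. (\<Sum>j=1..N. ln (real j) ^ k / real j) - ln (real N) ^ (k + 1) / real (k + 1)"
  let ?P = "\<lambda>N i. \<Sum>n<N. harm (Suc n) ^ i / real (Suc n) ^ (Suc m - i)"
  have log: "(ln (real (Suc n)) + euler_mascheroni) ^ m / real (Suc n) = (\<Sum>k=0..m. ?c k * (ln (real (Suc n)) ^ k / real (Suc n)))" for n
    by (simp add: binomial_ring atLeast0AtMost sum_divide_distrib mult_ac del: of_nat_Suc)
  \<comment> \<open>An exact identity for every N, arranged so that each group on the right has its
    own limit.\<close>
  have partial: "(\<Sum>n<N. harm_log_diff m n / real (Suc n)) =
      (harm N ^ Suc m - (ln (real N) + euler_mascheroni) ^ Suc m) / real (Suc m) + euler_mascheroni ^ Suc m / real (Suc m)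
      + (\<Sum>i<m. ?b i * ?P N i) / real (Suc m) - (\<Sum>k=0..m. ?c k * ?S k N)" for N
  proof -
    have "(\<Sum>n<N. harm_log_diff m n / real (Suc n)) =
       (\<Sum>n<N. harm (Suc n) ^ m / real (Suc n)) - (\<Sum>n<N. (ln (real (Suc n)) + euler_mascheroni) ^ m / real (Suc n))"
      by (simp add: harm_log_diff_def diff_divide_distrib sum_subtractf del: of_nat_Suc)
    also have "(\<Sum>n<N. harm (Suc n) ^ m / real (Suc n)) = (\<Sum>n<N. harm (Suc n) ^ Suc m - harm n ^ Suc m) / real (Suc m)
        + (\<Sum>n<N. \<Sum>i<m. ?b i * (harm (Suc n) ^ i / real (Suc n) ^ (Suc m - i))) / real (Suc m)"
      unfolding harm_power_div_telescope sum.distrib sum_divide_distrib [symmetric] ..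
    also have "(\<Sum>n<N. harm (Suc n) ^ Suc m - harm n ^ Suc m) = harm N ^ Suc m"
      by (subst sum_lessThan_telescope) (simp add: harm_def)
    also have "(\<Sum>n<N. \<Sum>i<m. ?b i * (harm (Suc n) ^ i / real (Suc n) ^ (Suc m - i))) = (\<Sum>i<m. ?b i * ?P N i)"
      by (subst sum.swap) (simp only: sum_distrib_left)
    also have "(\<Sum>n<N. (ln (real (Suc n)) + euler_mascheroni) ^ m / real (Suc n))
       = (\<Sum>k=0..m. ?c k * (\<Sum>n<N. ln (real (Suc n)) ^ k / real (Suc n)))"
      unfolding log by (subst sum.swap) (simp only: sum_distrib_left)
    also have "\<dots> = (\<Sum>k=0..m. ?c k * ?S k N + ?c k * (ln (real N) ^ Suc k / real (Suc k)))"
    proof (intro sum.cong refl)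
      fix k
      have "(\<Sum>n<N. ln (real (Suc n)) ^ k / real (Suc n)) = (\<Sum>j=1..N. ln (real j) ^ k / real j)"
        by (rule sum.reindex_bij_witness[of _ "\<lambda>j. j - 1" Suc]) auto
      then show "?c k * (\<Sum>n<N. ln (real (Suc n)) ^ k / real (Suc n)) = ?c k * ?S k N + ?c k * (ln (real N) ^ Suc k / real (Suc k))"
        by (simp add: right_diff_distrib del: of_nat_Suc power_Suc)
    qed
    also have "\<dots> = (\<Sum>k=0..m. ?c k * ?S k N) + ((ln (real N) + euler_mascheroni) ^ Suc m - euler_mascheroni ^ Suc m) / real (Suc m)"
      unfolding sum.distrib sum_binomial_div_Suc ..
    finally show ?thesis
      by (simp only: diff_divide_distrib)
  qed
  \<comment> \<open>The deviation of the powers with exponent m + 1, not m;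
    \<open>harm_log_diff\<close> is indexed from n + 1, hence the shift.\<close>
  have "(\<lambda>N. harm N ^ Suc m - (ln (real N) + euler_mascheroni) ^ Suc m) \<longlonglongrightarrow> 0"
    using harm_log_diff_LIMSEQ[of "Suc m"] unfolding harm_log_diff_def by (rule LIMSEQ_imp_Suc)
  moreover have "(\<lambda>N. ?P N i) \<longlonglongrightarrow> harm_sum i (Suc m - i)" if "i < m" for i
    using harm_sum_sums[of "Suc m - i" i] that unfolding sums_def by simp
  ultimately have "(\<lambda>N. (harm N ^ Suc m - (ln (real N) + euler_mascheroni) ^ Suc m) / real (Suc m) + euler_mascheroni ^ Suc m / real (Suc m)
      + (\<Sum>i<m. ?b i * ?P N i) / real (Suc m) - (\<Sum>k=0..m. ?c k * ?S k N)) \<longlonglongrightarrow>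
      0 / real (Suc m) + euler_mascheroni ^ Suc m / real (Suc m)
      + (\<Sum>i<m. ?b i * harm_sum i (Suc m - i)) / real (Suc m) - (\<Sum>k=0..m. ?c k * stieltjes k)"
    by (intro tendsto_diff tendsto_add tendsto_divide tendsto_sum tendsto_mult tendsto_const stieltjes_LIMSEQ) auto
  then show ?thesis
    unfolding sums_def partial by simp
qed

lemma riemann_zeta_eq: "riemann_zeta = harm_zeta 0"
  by (simp add: riemann_zeta_def harm_zeta_def)

text \<open>The index set \<open>{k. k + 2 \<le> m}\<close> is empty for m = 1, whereas the upper
  limit m - 2, truncated to 0, would admit k = 0.\<close>

theorem theorem6:
  fixes m :: nat
  assumes "m \<ge> 1"
  shows "summable (\<lambda>n. (harm (Suc n) ^ m - (ln (real (Suc n)) + euler_mascheroni) ^ m) / real (Suc n))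
    \<and> complex_of_real (\<Sum>n. (harm (Suc n) ^ m - (ln (real (Suc n)) + euler_mascheroni) ^ m) / real (Suc n))
         = harm_stieltjes m 0
           - (\<Sum>k=0..m. of_nat (m choose k) * euler_mascheroni ^ (m - k) * of_real (stieltjes k))
    \<and> harm_stieltjes m 0
           - (\<Sum>k=0..m. of_nat (m choose k) * euler_mascheroni ^ (m - k) * of_real (stieltjes k))
         = - (of_nat m / of_nat (m + 1)) * euler_mascheroni ^ (m + 1)
           + (-1) ^ (m + 1) * riemann_zeta (of_nat (m + 1)) / of_nat (m + 1)
           + (\<Sum>k | k + 2 \<le> m. of_nat ((m + 1) choose (k + 1)) *
                ((-1) ^ (k + m) * harm_zeta (k + 1) (of_nat (m - k)) / of_nat (m + 1)))
           - (\<Sum>k=1..m. of_nat (m choose k) * of_real (stieltjes k) * euler_mascheroni ^ (m - k))"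
proof (intro conjI)
  show "summable (\<lambda>n. (harm (Suc n) ^ m - (ln (real (Suc n)) + euler_mascheroni) ^ m) / real (Suc n))"
    using summable_harm_log_diff[of m] unfolding harm_log_diff_def .
  show "complex_of_real (\<Sum>n. (harm (Suc n) ^ m - (ln (real (Suc n)) + euler_mascheroni) ^ m) / real (Suc n))
         = harm_stieltjes m 0
           - (\<Sum>k=0..m. of_nat (m choose k) * euler_mascheroni ^ (m - k) * of_real (stieltjes k))"
    using suminf_harm_log_diff[of m] unfolding harm_log_diff_def .
  obtain q where q: "m = Suc q"
    using assms by (cases m) auto
  let ?g = "euler_mascheroni :: complex"
  let ?M = "of_nat (Suc m) :: complex"
  let ?t = "\<lambda>i. of_nat (Suc m choose i) * (-1) ^ (Suc m - i) * harm_zeta i (of_nat (Suc m - i)) :: complex"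
  let ?s = "\<lambda>k. of_nat (m choose k) * ?g ^ (m - k) * of_real (stieltjes k)"
  let ?S = "\<Sum>k | k + 2 \<le> m. of_nat ((m + 1) choose (k + 1)) * ((-1) ^ (k + m) * harm_zeta (k + 1) (of_nat (m - k)) / ?M)"
  let ?B = "\<Sum>k=1..m. of_nat (m choose k) * of_real (stieltjes k) * ?g ^ (m - k)"
  \<comment> \<open>The shift i = k + 1 sets the term i = 0 apart, which is the zeta value. The
    signs agree since k + m and m - k have the same parity.\<close>
  have "(\<Sum>k<q. ?t (Suc k) / ?M) = ?S"
  proof (rule sum.cong)
    show "{..<q} = {k. k + 2 \<le> m}"
      by (auto simp: q)
    fix k assume "k \<in> {k. k + 2 \<le> m}"
    then have "(-1 :: complex) ^ (k + m) = (-1) ^ (m - k)"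
      by (auto simp: minus_one_power_iff)
    then show "?t (Suc k) / ?M = of_nat ((m + 1) choose (k + 1)) * ((-1) ^ (k + m) * harm_zeta (k + 1) (of_nat (m - k)) / ?M)"
      by (simp del: binomial_Suc_Suc of_nat_Suc)
  qed
  moreover have "?t 0 = (-1) ^ (m + 1) * riemann_zeta (of_nat (m + 1))"
    by (simp add: riemann_zeta_eq)
  ultimately have t: "(\<Sum>i<m. ?t i) / ?M = (-1) ^ (m + 1) * riemann_zeta (of_nat (m + 1)) / ?M + ?S"
    unfolding q sum.lessThan_Suc_shift by (simp only: add_divide_distrib sum_divide_distrib)
  \<comment> \<open>The k = 0 term is gamma^m times \<open>stieltjes 0\<close>, that is
    gamma^(m+1).\<close>
  have s: "(\<Sum>k=0..m. ?s k) = ?g ^ (m + 1) + ?B"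
    by (subst sum.atLeast_Suc_atMost) (simp_all add: stieltjes_0 mult_ac)
  have "?M \<noteq> 0"
    by (simp del: of_nat_Suc)
  \<comment> \<open>Uses 1/(m+1) = 1 - m/(m+1), so that the full power cancels against the one
    isolated in \<open>s\<close>.\<close>
  then have g: "?g ^ Suc m / ?M = ?g ^ (m + 1) - of_nat m / ?M * ?g ^ (m + 1)"
    by (simp add: field_simps)
  have "harm_stieltjes m 0 - (\<Sum>k=0..m. ?s k) = complex_of_real (\<Sum>n. harm_log_diff m n / real (Suc n))"
    by (rule suminf_harm_log_diff [symmetric])
  also have "\<dots> = ?g ^ Suc m / ?M + (\<Sum>i<m. ?t i) / ?M - (\<Sum>k=0..m. ?s k)"
    unfolding sums_unique[OF harm_log_diff_sums, symmetric]
    by (simp add: of_real_harm_sum cong: sum.cong_simp del: of_nat_Suc power_Suc binomial_Suc_Suc)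
  also have "\<dots> = - (of_nat m / ?M) * ?g ^ (m + 1) + (-1) ^ (m + 1) * riemann_zeta (of_nat (m + 1)) / ?M + ?S - ?B"
    unfolding t s g by (simp only: minus_mult_left [symmetric]) simp
  finally show "harm_stieltjes m 0 - (\<Sum>k=0..m. ?s k)
         = - (of_nat m / of_nat (m + 1)) * ?g ^ (m + 1)
           + (-1) ^ (m + 1) * riemann_zeta (of_nat (m + 1)) / of_nat (m + 1)
           + (\<Sum>k | k + 2 \<le> m. of_nat ((m + 1) choose (k + 1)) *
                ((-1) ^ (k + m) * harm_zeta (k + 1) (of_nat (m - k)) / of_nat (m + 1)))
           - (\<Sum>k=1..m. of_nat (m choose k) * of_real (stieltjes k) * ?g ^ (m - k))"
    unfolding Suc_eq_plus1 .
qed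

end
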